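(* Let $H$ be a real Hilbert space, let $f, g \in \Gamma_0(H)$ with $\mathrm{dom}(f) \cap \mathrm{dom}(g) \neq \emptyset$ and such that $\partial(f+g) = \partial f + \partial g$, and let $x \in H$. If $\mathrm{prox}_g(x) \in \mathrm{prox}^f_g(x)$, then $$\mathrm{prox}_g(x) = \mathrm{proj}_{\mathrm{prox}^f_g(x)}\big(\mathrm{prox}_{f+g}(x)\big).$$
   Context: $\Gamma_0(H)$ is the set of proper, lower semicontinuous, convex functions $H \to \mathbb{R} \cup \{+\infty\}$. For $g : H \to \mathbb{R}\cup\{+\infty\}$, $\mathrm{dom}(g) = \{x \in H : g(x) < +\infty\}$. For $g \in \Gamma_0(H)$, the subdifferential is the set-valued map $\partial g(x) = \{ y \in H : \langle y, z-x\rangle \le g(z)-g(x)\ \forall z \in H\}$. Sums of set-valued maps are pointwise Minkowski sums (empty if one of the summands is empty). For a set-valued map $A : H \rightrightarrows H$, $A^{-1}(y) = \{x \in H : y \in A(x)\}$; $I$ is the identity operator. The proximal operator of $g \in \Gamma_0(H)$ is $\mathrm{prox}_g = (I+\partial g)^{-1}$, which is single-valued and defined everywhere on $H$. The $f$-proximal operator of $g$ is the set-valued map $\mathrm{prox}^f_g : H \rightrightarrows H$ defined by $\mathrm{prox}^f_g = (I + \partial g \circ \mathrm{prox}_f)^{-1}$; that is, $y \in \mathrm{prox}^f_g(x)$ if and only if $x - y \in \partial g(\mathrm{prox}_f(y))$. For a nonempty closed convex subset $K \subset H$, $\mathrm{proj}_K$ denotes the projection operator onto $K$. The set $\mathrm{prox}^f_g(x)$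 is closed and convex whenever it is nonempty, so the projection in the claim is well defined. *)

theory Defs
  imports "HOL-Analysis.Analysis" "HOL-Library.Set_Algebras"
begin

definition effective_domain :: "('a \<Rightarrow> ereal) \<Rightarrow> 'a set" where
  "effective_domain g = {x. g x < \<infinity>}"

definition proper :: "('a \<Rightarrow> ereal) \<Rightarrow> bool" where
  "proper g \<longleftrightarrow> (\<forall>x. g x \<noteq> -\<infinity>) \<and> effective_domain g \<noteq> {}"

text \<open>The filter \<^term>\<open>at x\<close> is punctured; including \<^term>\<open>x\<close> itself would not change the condition.\<close>

definition lower_semicontinuous :: "('a::topological_space \<Rightarrow> ereal) \<Rightarrow> bool" where
  "lower_semicontinuous g \<longleftrightarrow> (\<forall>x. g x \<le> Liminf (at x) g)"

text \<open>The library's \<^const>\<open>convex_on\<close> only covers real-valued functions.\<close>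

definition convex_ereal :: "('a::real_vector \<Rightarrow> ereal) \<Rightarrow> bool" where
  "convex_ereal g \<longleftrightarrow>
     (\<forall>x y t. 0 < t \<and> t < 1 \<longrightarrow>
        g ((1 - t) *\<^sub>R x + t *\<^sub>R y) \<le> ereal (1 - t) * g x + ereal t * g y)"

definition Gamma0 :: "('a::real_normed_vector \<Rightarrow> ereal) set" where
  "Gamma0 = {g. proper g \<and> lower_semicontinuous g \<and> convex_ereal g}"

text \<open>
  In \<^typ>\<open>ereal\<close>, \<open>\<infinity> - \<infinity> = \<infinity>\<close>. For proper \<^term>\<open>g\<close> and \<^term>\<open>x\<close> outside the effective
  domain the set is therefore empty, as intended: any \<^term>\<open>z\<close> in the effective domain gives
  \<open>g z - g x = -\<infinity>\<close>.
\<close>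

definition subdifferential :: "('a::real_inner \<Rightarrow> ereal) \<Rightarrow> 'a \<Rightarrow> 'a set" where
  "subdifferential g x = {y. \<forall>z. ereal (inner y (z - x)) \<le> g z - g x}"

text \<open>
  Set-valued maps on \<open>H\<close> are functions \<open>'a \<Rightarrow> 'a set\<close>; the sum of their values is the
  Minkowski sum of \<^theory>\<open>HOL-Library.Set_Algebras\<close>.
\<close>

definition sv_plus :: "('a \<Rightarrow> 'b::plus set) \<Rightarrow> ('a \<Rightarrow> 'b set) \<Rightarrow> 'a \<Rightarrow> 'b set" where
  "sv_plus A B = (\<lambda>x. A x + B x)"

definition sv_inverse :: "('a \<Rightarrow> 'b set) \<Rightarrow> 'b \<Rightarrow> 'a set" where
  "sv_inverse A y = {x. y \<in> A x}"

definition sv_id :: "'a \<Rightarrow> 'a set" where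
  "sv_id x = {x}"

text \<open>
  For \<^term>\<open>g \<in> Gamma0\<close> on a Hilbert space the resolvent \<open>(I + \<partial>g)\<^sup>-\<^sup>1\<close> takes exactly one value
  at every point, so the description is well defined.
\<close>

definition prox :: "('a::real_inner \<Rightarrow> ereal) \<Rightarrow> 'a \<Rightarrow> 'a" where
  "prox g x = (THE y. y \<in> sv_inverse (sv_plus sv_id (subdifferential g)) x)"

definition fprox :: "('a::real_inner \<Rightarrow> ereal) \<Rightarrow> ('a \<Rightarrow> ereal) \<Rightarrow> 'a \<Rightarrow> 'a set" where
  "fprox f g = sv_inverse (sv_plus sv_id (subdifferential g \<circ> prox f))"

lemma mem_fprox_iff: "y \<in> fprox f g x \<longleftrightarrow> x - y \<in> subdifferential g (prox f y)"
  by (auto simp: fprox_def sv_inverse_def sv_plus_def sv_id_def set_plus_def algebra_simps)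
     (metis add_diff_cancel_left' add.commute diff_add_cancel)

text \<open>
  The library's \<^const>\<open>closest_point\<close> is restricted to \<^class>\<open>heine_borel\<close> spaces, which excludes
  infinite-dimensional Hilbert spaces. The description is well defined for nonempty closed convex
  \<^term>\<open>K\<close> in a Hilbert space.
\<close>

definition proj :: "'a::metric_space set \<Rightarrow> 'a \<Rightarrow> 'a" where
  "proj K x = (THE y. y \<in> K \<and> (\<forall>z\<in>K. dist x y \<le> dist x z))"

end

theory Submission
  imports Defs
begin

text \<open>
  Write \<open>p = prox g x\<close> and \<open>K = fprox f g x\<close>. If \<open>y \<in> K\<close> and \<open>q = prox f y\<close>, then
  \<open>x - y \<in> \<partial>g q\<close> and \<open>y - q \<in> \<partial>f q\<close>; adding the two gives \<open>x - q \<in> \<partial>(f + g) q\<close>, that is,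
  \<open>q = prox (f + g) x\<close>. So \<open>prox f\<close> is constant on \<open>K\<close>, with value \<open>c = prox (f + g) x\<close>, and
  \<open>x - y \<in> \<partial>g c\<close> for every \<open>y \<in> K\<close>. On the other hand \<open>x - p \<in> \<partial>g p\<close>, so monotonicity of
  \<open>\<partial>g\<close> yields \<open>\<langle>c - p, y - p\<rangle> \<le> 0\<close> for every \<open>y \<in> K\<close>. Since \<open>p \<in> K\<close>, this variational inequality
  says that \<open>p\<close> is the projection of \<open>c\<close> onto \<open>K\<close> (\<open>proj_eqI\<close>).

  The argument uses \<open>y - prox f y \<in> \<partial>f (prox f y)\<close>, hence Moreau's theorem that the resolvent of
  \<open>\<partial>f\<close> has a value everywhere (\<open>diff_prox_in_subdifferential\<close>). That value is the minimizer
  of \<open>f + \<parallel>\<cdot> - y\<parallel>\<^sup>2 / 2\<close>. This function is bounded below because \<open>f\<close> decreases at most linearly,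
  and strong convexity makes minimizing sequences Cauchy. For \<open>f + g\<close> the point \<open>q\<close> itself is the
  value at \<open>x\<close>, and monotonicity of \<open>\<partial>(f + g)\<close> makes it the only one.
\<close>

section \<open>Extended-real functions through their finite values\<close>

lemma proper_eq_ereal:
  assumes "proper h" "z \<in> effective_domain h"
  shows "h z = ereal (real_of_ereal (h z))"
  using assms by (cases "h z") (auto simp: proper_def effective_domain_def)

lemma subdifferential_iff:
  assumes h: "proper h"
  shows "y \<in> subdifferential h c \<longleftrightarrow> c \<in> effective_domain h \<and>
    (\<forall>z\<in>effective_domain h. inner y (z - c) \<le> real_of_ereal (h z) - real_of_ereal (h c))"
proof (cases "c \<in> effective_domain h")
  case False
  obtain w where w: "w \<in> effective_domain h"
    using h by (auto simp: proper_def)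
  have hc: "h c = \<infinity>"
    using False by (simp add: effective_domain_def)
  have "h w - h c = -\<infinity>"
    using proper_eq_ereal[OF h w] hc by (metis ereal_minus(3))
  then have "\<not> ereal (inner y (w - c)) \<le> h w - h c"
    by simp
  then show ?thesis
    using False unfolding subdifferential_def by blast
next
  case True
  obtain r where r: "h c = ereal r"
    using proper_eq_ereal[OF h True] by blast
  have "ereal (inner y (z - c)) \<le> h z - h c \<longleftrightarrow>
    (z \<in> effective_domain h \<longrightarrow> inner y (z - c) \<le> real_of_ereal (h z) - real_of_ereal (h c))" for z
    using h r by (cases "h z") (auto simp: proper_def effective_domain_def)
  with True show ?thesis
    unfolding subdifferential_def by blast
qed

lemma Gamma0_proper: "f \<in> Gamma0 \<Longrightarrow> proper f"
  by (simp add: Gamma0_def)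

lemma Gamma0_eventually_less:
  assumes "f \<in> Gamma0" "b < f p"
  shows "\<forall>\<^sub>F z in nhds p. b < f z"
proof -
  have "f p \<le> Liminf (at p) f"
    using assms by (simp add: Gamma0_def lower_semicontinuous_def)
  then have "\<forall>\<^sub>F z in at p. b < f z"
    using assms(2) by (simp add: le_Liminf_iff)
  with assms(2) show ?thesis
    by (auto simp: eventually_at_filter elim: eventually_mono)
qed

lemma Gamma0_convex:
  assumes f: "f \<in> Gamma0" and a: "a \<in> effective_domain f" and b: "b \<in> effective_domain f"
    and t: "0 < t" "t < 1"
  shows "(1 - t) *\<^sub>R a + t *\<^sub>R b \<in> effective_domain f"
    and "real_of_ereal (f ((1 - t) *\<^sub>R a + t *\<^sub>R b))
      \<le> (1 - t) * real_of_ereal (f a) + t * real_of_ereal (f b)"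
proof -
  note fin = proper_eq_ereal[OF Gamma0_proper[OF f]]
  let ?w = "(1 - t) *\<^sub>R a + t *\<^sub>R b"
  obtain u v where uv: "f a = ereal u" "f b = ereal v"
    using fin[OF a] fin[OF b] by blast
  have "convex_ereal f"
    using f by (simp add: Gamma0_def)
  then have "f ?w \<le> ereal (1 - t) * f a + ereal t * f b"
    using t unfolding convex_ereal_def by blast
  then have le: "f ?w \<le> ereal ((1 - t) * u + t * v)"
    by (simp add: uv)
  then show w: "?w \<in> effective_domain f"
    by (auto simp: effective_domain_def)
  obtain s where "f ?w = ereal s"
    using fin[OF w] by blast
  then show "real_of_ereal (f ?w) \<le> (1 - t) * real_of_ereal (f a) + t * real_of_ereal (f b)"
    using le by (simp add: uv)
qed

section \<open>Subdifferentials and uniqueness of the proximal point\<close>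

text \<open>Adding the subgradient inequalities at the two points cancels the function values.\<close>

lemma subdifferential_monotone:
  assumes "proper h" "u \<in> subdifferential h a" "v \<in> subdifferential h b"
  shows "0 \<le> inner (u - v) (a - b)"
proof -
  have "inner u (b - a) \<le> real_of_ereal (h b) - real_of_ereal (h a)"
    and "inner v (a - b) \<le> real_of_ereal (h a) - real_of_ereal (h b)"
    using assms by (auto simp: subdifferential_iff)
  then show ?thesis
    by (simp add: inner_diff)
qed

lemma mem_resolvent_iff:
  "y \<in> sv_inverse (sv_plus sv_id A) x \<longleftrightarrow> x - y \<in> A y" for x y :: "'a::ab_group_add"
  by (auto simp: sv_inverse_def sv_plus_def sv_id_def set_plus_def)
     (metis add.commute diff_add_cancel)

lemma prox_eqI:
  assumes h: "proper h" and y: "x - y \<in> subdifferential h y"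
  shows "prox h x = y"
  unfolding prox_def mem_resolvent_iff
proof (rule the_equality)
  fix y' assume "x - y' \<in> subdifferential h y'"
  from subdifferential_monotone[OF h this y] have "0 \<le> inner (y - y') (y' - y)"
    by simp
  then have "inner (y' - y) (y' - y) \<le> 0"
    by (simp add: inner_diff)
  then show "y' = y"
    by (metis inner_eq_zero_iff inner_ge_zero order_antisym eq_iff_diff_eq_0)
qed (rule y)

section \<open>Existence of the proximal point\<close>

text \<open>
  Lower semicontinuity bounds \<open>f\<close> below near a point of its domain; along each ray from that point,
  convexity propagates this bound outwards with at most linear loss. This replaces the affine
  minorant that a separation theorem would give.
\<close>

lemma Gamma0_linear_lower_bound:
  assumes f: "f \<in> Gamma0" and a: "a \<in> effective_domain f"
  obtains C where "0 \<le> C"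
    and "\<And>z. z \<in> effective_domain f \<Longrightarrow>
      real_of_ereal (f a) - 1 - C * norm (z - a) \<le> real_of_ereal (f z)"
proof -
  note fin = proper_eq_ereal[OF Gamma0_proper[OF f]]
  define \<phi> where "\<phi> z = real_of_ereal (f z)" for z
  have fa: "f a = ereal (\<phi> a)"
    using fin[OF a] by (simp add: \<phi>_def)
  then have "ereal (\<phi> a - 1) < f a"
    by simp
  from Gamma0_eventually_less[OF f this]
  obtain r where r: "0 < r" "\<And>z. dist z a < r \<Longrightarrow> ereal (\<phi> a - 1) < f z"
    by (auto simp: eventually_nhds_metric)
  have near: "\<phi> a - 1 < \<phi> z" if "z \<in> effective_domain f" "dist z a < r" for z
    using r(2)[OF that(2)] fin[OF that(1)] unfolding \<phi>_def by (metis less_ereal.simps(1))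
  have "\<phi> a - 1 - 2 / r * norm (z - a) \<le> \<phi> z" if z: "z \<in> effective_domain f" for z
  proof (cases "norm (z - a) < r")
    case True
    moreover have "0 \<le> 2 / r * norm (z - a)"
      using r(1) by simp
    ultimately show ?thesis
      using near[OF z] by (simp add: dist_norm)
  next
    case False
    define n where "n = norm (z - a)"
    \<comment> \<open>the point at distance \<open>r / 2\<close> from \<open>a\<close> on the segment to \<open>z\<close> lies in the ball\<close>
    define t where "t = r / (2 * n)"
    have n: "r \<le> n" "0 < n"
      using False r(1) by (auto simp: n_def)
    have t: "0 < t" "t < 1"
      using n r(1) by (auto simp: t_def field_simps)
    let ?w = "(1 - t) *\<^sub>R a + t *\<^sub>R z"
    have "?w - a = t *\<^sub>R (z - a)"
      by (simp add: algebra_simps)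
    then have "dist ?w a = t * n"
      using t by (simp add: dist_norm n_def)
    also have "\<dots> < r"
      using n r(1) by (simp add: t_def)
    finally have "\<phi> a - 1 < \<phi> ?w"
      using near Gamma0_convex(1)[OF f a z t] by blast
    also have "\<dots> \<le> (1 - t) * \<phi> a + t * \<phi> z"
      using Gamma0_convex(2)[OF f a z t] by (simp add: \<phi>_def)
    finally have "- 1 < t * (\<phi> z - \<phi> a)"
      by (simp add: algebra_simps)
    then have "- (1 / t) < \<phi> z - \<phi> a"
      using t by (simp add: field_simps)
    moreover have "1 / t = 2 / r * n"
      using n r(1) by (simp add: t_def)
    ultimately show ?thesis
      by (simp add: n_def)
  qed
  then show thesis
    using that[of "2 / r"] r(1) by (simp add: \<phi>_def)
qed

text \<open>
  The linear lower bound loses against the quadratic term, so the infimum \<open>m\<close> exists. Comparing with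
  the midpoint, the parallelogram law bounds the squared distance of two almost minimizing points by
  a multiple of their excess over \<open>m\<close>; a minimizing sequence is therefore Cauchy, and lower
  semicontinuity carries the bound to its limit.
\<close>

lemma Gamma0_regularized_minimizer:
  fixes f :: "'a::{real_inner, banach} \<Rightarrow> ereal"
  assumes f: "f \<in> Gamma0"
  obtains p where "p \<in> effective_domain f"
    and "\<And>z. z \<in> effective_domain f \<Longrightarrow>
      real_of_ereal (f p) + (norm (p - y))\<^sup>2 / 2 \<le> real_of_ereal (f z) + (norm (z - y))\<^sup>2 / 2"
proof -
  note fin = proper_eq_ereal[OF Gamma0_proper[OF f]]
  let ?D = "effective_domain f"
  define \<phi> where "\<phi> z = real_of_ereal (f z)" for z
  define F where "F z = \<phi> z + (norm (z - y))\<^sup>2 / 2" for z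
  obtain a where a: "a \<in> ?D"
    using Gamma0_proper[OF f] by (auto simp: proper_def)
  obtain C where C: "0 \<le> C" "\<And>z. z \<in> ?D \<Longrightarrow> \<phi> a - 1 - C * norm (z - a) \<le> \<phi> z"
    using Gamma0_linear_lower_bound[OF f a] unfolding \<phi>_def by metis
  have bdd: "bdd_below (F ` ?D)"
  proof (rule bdd_belowI2)
    fix z assume z: "z \<in> ?D"
    have "norm (z - a) \<le> norm (z - y) + norm (y - a)"
      using norm_triangle_ineq[of "z - y" "y - a"] by simp
    then have "C * norm (z - a) \<le> C * norm (z - y) + C * norm (y - a)"
      using C(1) mult_left_mono[of _ _ C] by (fastforce simp: distrib_left)
    moreover have "C * norm (z - y) \<le> C\<^sup>2 / 2 + (norm (z - y))\<^sup>2 / 2"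
      using sum_squares_bound[of C "norm (z - y)"] by simp
    ultimately show "\<phi> a - 1 - C * norm (y - a) - C\<^sup>2 / 2 \<le> F z"
      using C(2)[OF z] by (simp add: F_def)
  qed
  define m where "m = Inf (F ` ?D)"
  have m_le: "m \<le> F z" if "z \<in> ?D" for z
    unfolding m_def using bdd that by (rule cINF_lower)
  have "\<exists>z\<in>?D. F z < m + 1 / real (Suc n)" for n
  proof -
    have "Inf (F ` ?D) < m + 1 / real (Suc n)"
      by (simp add: m_def)
    then show ?thesis
      using a bdd by (subst (asm) cInf_less_iff) auto
  qed
  then obtain s where s: "\<And>n. s n \<in> ?D" "\<And>n. F (s n) < m + 1 / real (Suc n)"
    by metis
  have close: "(norm (u - v))\<^sup>2 \<le> 4 * (F u - m) + 4 * (F v - m)" if u: "u \<in> ?D" and v: "v \<in> ?D" for u v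
  proof -
    let ?w = "(1 - 1 / 2) *\<^sub>R u + (1 / 2 :: real) *\<^sub>R v"
    have w: "?w \<in> ?D" "\<phi> ?w \<le> \<phi> u / 2 + \<phi> v / 2"
      using Gamma0_convex[OF f u v, of "1 / 2"] by (simp_all add: \<phi>_def)
    have mid: "?w - y = (1 / 2) *\<^sub>R ((u - y) + (v - y))"
      by (simp add: algebra_simps flip: scaleR_add_left)
    have "(norm (?w - y))\<^sup>2 = (norm ((u - y) + (v - y)))\<^sup>2 / 4"
      unfolding mid by (simp add: power_divide)
    moreover have "(norm ((u - y) + (v - y)))\<^sup>2 + (norm ((u - y) - (v - y)))\<^sup>2
        = 2 * (norm (u - y))\<^sup>2 + 2 * (norm (v - y))\<^sup>2"
      unfolding power2_norm_eq_inner by (simp add: inner_add inner_diff inner_commute)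
    ultimately have "F ?w \<le> F u / 2 + F v / 2 - (norm (u - v))\<^sup>2 / 8"
      using w(2) unfolding F_def by simp argo
    with m_le[OF w(1)] show ?thesis
      by simp
  qed
  have "Cauchy s"
  proof (rule metric_CauchyI)
    fix e :: real assume e: "0 < e"
    obtain N where N: "1 / real (Suc N) < e\<^sup>2 / 8"
      using reals_Archimedean[of "e\<^sup>2 / 8"] e by (auto simp: inverse_eq_divide)
    have excess: "F (s n) - m < e\<^sup>2 / 8" if "N \<le> n" for n
    proof -
      have "1 / real (Suc n) \<le> 1 / real (Suc N)"
        using that by (simp add: frac_le)
      then show ?thesis
        using s(2)[of n] N by linarith
    qed
    have "dist (s i) (s j) < e" if "N \<le> i" "N \<le> j" for i j
    proof -
      have "(norm (s i - s j))\<^sup>2 < e\<^sup>2"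
        using close[OF s(1)[of i] s(1)[of j]] excess[OF that(1)] excess[OF that(2)] by argo
      then show ?thesis
        using e by (simp add: dist_norm power_less_imp_less_base)
    qed
    then show "\<exists>N. \<forall>i\<ge>N. \<forall>j\<ge>N. dist (s i) (s j) < e"
      by blast
  qed
  then obtain p where p: "s \<longlonglongrightarrow> p"
    using Cauchy_convergent convergent_def by blast
  let ?b = "m - (norm (p - y))\<^sup>2 / 2"
  have fp: "f p \<le> ereal ?b"
  proof (rule ccontr)
    assume "\<not> f p \<le> ereal ?b"
    then obtain k where k: "ereal ?b < ereal k" "ereal k < f p"
      by (metis ereal_dense2 not_le)
    have "\<forall>\<^sub>F n in sequentially. ereal k < f (s n)"
      using Gamma0_eventually_less[OF f k(2)] p by (rule eventually_compose_filterlim)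
    moreover have "k \<le> m + 1 / real (Suc n) - (norm (s n - y))\<^sup>2 / 2" if "ereal k < f (s n)" for n
    proof -
      have "f (s n) = ereal (\<phi> (s n))"
        using fin[OF s(1)] by (simp add: \<phi>_def)
      with that have "k < \<phi> (s n)"
        by simp
      then show ?thesis
        using s(2)[of n] by (simp add: F_def)
    qed
    ultimately have "\<forall>\<^sub>F n in sequentially. k \<le> m + 1 / real (Suc n) - (norm (s n - y))\<^sup>2 / 2"
      by (auto elim: eventually_mono)
    moreover have "(\<lambda>n. m + 1 / real (Suc n) - (norm (s n - y))\<^sup>2 / 2)
        \<longlonglongrightarrow> m + 0 - (norm (p - y))\<^sup>2 / 2"
      by (intro tendsto_intros p filterlim_compose[OF lim_inverse_n' filterlim_Suc]) simp
    ultimately have "k \<le> m + 0 - (norm (p - y))\<^sup>2 / 2"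
      by (intro tendsto_lowerbound) auto
    with k(1) show False
      by simp
  qed
  show thesis
  proof
    show pD: "p \<in> ?D"
      using fp by (auto simp: effective_domain_def)
    have "\<phi> p \<le> ?b"
      using fp fin[OF pD] unfolding \<phi>_def by (metis ereal_less_eq(3))
    then have "F p \<le> m"
      by (simp add: F_def)
    then show "real_of_ereal (f p) + (norm (p - y))\<^sup>2 / 2
        \<le> real_of_ereal (f z) + (norm (z - y))\<^sup>2 / 2" if "z \<in> ?D" for z
      using m_le[OF that] by (simp add: F_def \<phi>_def)
  qed
qed

text \<open>
  First-order optimality at the minimizer \<open>p\<close>: comparing it with \<open>p + t (z - p)\<close> gives the
  subgradient inequality at \<open>p\<close> up to the error \<open>t \<parallel>z - p\<parallel>\<^sup>2 / 2\<close>, which vanishes with \<open>t\<close>.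
\<close>

lemma diff_prox_in_subdifferential:
  fixes f :: "'a::{real_inner, banach} \<Rightarrow> ereal"
  assumes f: "f \<in> Gamma0"
  shows "y - prox f y \<in> subdifferential f (prox f y)"
proof -
  let ?D = "effective_domain f"
  define \<phi> where "\<phi> z = real_of_ereal (f z)" for z
  obtain p where p: "p \<in> ?D"
    and min: "\<And>z. z \<in> ?D \<Longrightarrow> \<phi> p + (norm (p - y))\<^sup>2 / 2 \<le> \<phi> z + (norm (z - y))\<^sup>2 / 2"
    using Gamma0_regularized_minimizer[OF f, of y] unfolding \<phi>_def by metis
  have "inner (y - p) (z - p) \<le> \<phi> z - \<phi> p" if z: "z \<in> ?D" for z
  proof -
    have approx: "inner (y - p) (z - p) \<le> \<phi> z - \<phi> p + t * ((norm (z - p))\<^sup>2 / 2)"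
      if t: "0 < t" "t < 1" for t
    proof -
      let ?w = "(1 - t) *\<^sub>R p + t *\<^sub>R z"
      have w: "?w \<in> ?D" "\<phi> ?w \<le> (1 - t) * \<phi> p + t * \<phi> z"
        using Gamma0_convex[OF f p z t] by (simp_all add: \<phi>_def)
      have eq: "?w - y = (p - y) + t *\<^sub>R (z - p)"
        by (simp add: algebra_simps)
      have "(norm (?w - y))\<^sup>2
          = (norm (p - y))\<^sup>2 + 2 * t * inner (p - y) (z - p) + t\<^sup>2 * (norm (z - p))\<^sup>2"
        unfolding eq power2_norm_eq_inner
        by (simp add: inner_add_left inner_add_right inner_commute power2_eq_square)
      then have "0 \<le> t * (\<phi> z - \<phi> p + inner (p - y) (z - p) + t * ((norm (z - p))\<^sup>2 / 2))"
        using min[OF w(1)] w(2) by (simp add: algebra_simps power2_eq_square)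
      then have "0 \<le> \<phi> z - \<phi> p + inner (p - y) (z - p) + t * ((norm (z - p))\<^sup>2 / 2)"
        using t by (simp add: zero_le_mult_iff)
      moreover have "inner (p - y) (z - p) = - inner (y - p) (z - p)"
        by (metis inner_minus_left minus_diff_eq)
      ultimately show ?thesis
        by simp
    qed
    have "((\<lambda>t. \<phi> z - \<phi> p + t * ((norm (z - p))\<^sup>2 / 2))
        \<longlongrightarrow> \<phi> z - \<phi> p + 0 * ((norm (z - p))\<^sup>2 / 2)) (at_right 0)"
      by (intro tendsto_intros)
    moreover have "\<forall>\<^sub>F t in at_right 0.
        inner (y - p) (z - p) \<le> \<phi> z - \<phi> p + t * ((norm (z - p))\<^sup>2 / 2)"
      using approx by (auto simp: eventually_at_right_field intro!: exI[of _ 1])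
    ultimately have "inner (y - p) (z - p) \<le> \<phi> z - \<phi> p + 0 * ((norm (z - p))\<^sup>2 / 2)"
      by (intro tendsto_lowerbound) auto
    then show ?thesis
      by simp
  qed
  with p have "y - p \<in> subdifferential f p"
    by (simp add: subdifferential_iff[OF Gamma0_proper[OF f]] \<phi>_def)
  with prox_eqI[OF Gamma0_proper[OF f] this] show ?thesis
    by simp
qed

section \<open>Projection and the conclusion\<close>

text \<open>
  The obtuse-angle condition gives \<open>\<parallel>c - y\<parallel>\<^sup>2 \<ge> \<parallel>c - p\<parallel>\<^sup>2 + \<parallel>p - y\<parallel>\<^sup>2\<close> on \<open>K\<close>, so \<open>p\<close> is the
  strict minimizer of the distance to \<open>c\<close>.
\<close>

lemma proj_eqI:
  fixes c p :: "'a::real_inner"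
  assumes p: "p \<in> K" and obtuse: "\<And>y. y \<in> K \<Longrightarrow> inner (c - p) (y - p) \<le> 0"
  shows "proj K c = p"
proof -
  have pyth: "(dist c p)\<^sup>2 + (dist p y)\<^sup>2 \<le> (dist c y)\<^sup>2" if "y \<in> K" for y
    using obtuse[OF that] unfolding dist_norm power2_norm_eq_inner
    by (simp add: inner_diff inner_commute)
  have le: "dist c p \<le> dist c y" if "y \<in> K" for y
  proof (rule power2_le_imp_le)
    show "(dist c p)\<^sup>2 \<le> (dist c y)\<^sup>2"
      using pyth[OF that] zero_le_power2[of "dist p y"] by linarith
  qed simp
  show ?thesis
    unfolding proj_def
  proof (rule the_equality)
    fix y assume y: "y \<in> K \<and> (\<forall>z\<in>K. dist c y \<le> dist c z)"
    then have "(dist c y)\<^sup>2 \<le> (dist c p)\<^sup>2"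
      using p by (simp add: power_mono)
    then have "(dist p y)\<^sup>2 \<le> 0"
      using pyth[of y] y by linarith
    then show "y = p"
      by simp
  qed (use p le in blast)
qed

text \<open>
  The residual \<open>x - y\<close>, a subgradient of \<open>g\<close>, and the residual \<open>y - prox f y\<close>, a subgradient of \<open>f\<close>
  at the same point, telescope to \<open>x - prox f y\<close>.
\<close>

lemma prox_fprox_eq_prox_add:
  fixes f g :: "'a::{real_inner, banach} \<Rightarrow> ereal"
  assumes f: "f \<in> Gamma0" and g: "g \<in> Gamma0"
    and dom: "effective_domain f \<inter> effective_domain g \<noteq> {}"
    and sum: "subdifferential (\<lambda>z. f z + g z) = sv_plus (subdifferential f) (subdifferential g)"
    and y: "y \<in> fprox f g x"
  shows "prox f y = prox (\<lambda>z. f z + g z) x"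
proof -
  let ?q = "prox f y"
  have "proper (\<lambda>z. f z + g z)"
    using Gamma0_proper[OF f] Gamma0_proper[OF g] dom
    by (auto simp: proper_def effective_domain_def)
  moreover have "(y - ?q) + (x - y) \<in> subdifferential f ?q + subdifferential g ?q"
    using diff_prox_in_subdifferential[OF f] y by (intro set_plus_intro) (simp_all add: mem_fprox_iff)
  then have "x - ?q \<in> subdifferential (\<lambda>z. f z + g z) ?q"
    by (simp add: sum sv_plus_def)
  ultimately show ?thesis
    by (rule prox_eqI[symmetric])
qed

theorem proposition2p15:
  fixes f g :: "'a::{real_inner, banach} \<Rightarrow> ereal" and x :: 'a
  assumes "f \<in> Gamma0" and "g \<in> Gamma0"
    and "effective_domain f \<inter> effective_domain g \<noteq> {}"
    and "subdifferential (\<lambda>z. f z + g z) = sv_plus (subdifferential f) (subdifferential g)"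
    and "prox g x \<in> fprox f g x"
  shows "prox g x = proj (fprox f g x) (prox (\<lambda>z. f z + g z) x)"
proof (rule proj_eqI[symmetric])
  show "prox g x \<in> fprox f g x"
    by fact
next
  fix y assume y: "y \<in> fprox f g x"
  let ?c = "prox (\<lambda>z. f z + g z) x" and ?p = "prox g x"
  have "x - y \<in> subdifferential g ?c"
    using y prox_fprox_eq_prox_add[OF assms(1-4) y] by (simp add: mem_fprox_iff)
  then have "0 \<le> inner ((x - y) - (x - ?p)) (?c - ?p)"
    using subdifferential_monotone Gamma0_proper diff_prox_in_subdifferential assms(2) by blast
  then show "inner (?c - ?p) (y - ?p) \<le> 0"
    by (simp add: inner_diff inner_commute)
qed

end
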